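(* For every $M>0$ there exists an instance with only one category ($K=1$) such that the optimal value of (RAOC) is at least $M$ times larger than the optimal value of (DAOC); that is, the optimal value $z_{\mathrm d}$ of (DAOC) is positive and the optimal value $z_{\mathrm r}$ of (RAOC) satisfies $z_{\mathrm r}/z_{\mathrm d}\ge M$.
   Context: An instance consists of products $\mathcal N=\{1,\dots,n\}$ with revenues $r_i\ge0$ and preference weights $v_i>0$, categories $C_1,\dots,C_K\subseteq\mathcal N$, and integer thresholds $0\le\ell_k\le|C_k|$. For $S\subseteq\mathcal N$ let $R(S)=\dfrac{\sum_{i\in S}r_iv_i}{1+\sum_{i\in S}v_i}$. (DAOC): maximize $R(S)$ over $S\subseteq\mathcal N$ subject to $|S\cap C_k|\ge\ell_k$ for all $k\in\{1,\dots,K\}$. (RAOC): maximize $\sum_{S\subseteq\mathcal N}R(S)q(S)$ over functions $q:2^{\mathcal N}\to\mathbb R$ subject to $\sum_{S\subseteq\mathcal N}|S\cap C_k|q(S)\ge\ell_k$ for all $k$, $\sum_{S\subseteq\mathcal N}q(S)=1$, and $q(S)\ge0$ for all $S\subseteq\mathcal N$. *)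

theory Defs
  imports Complex_Main
begin

text \<open>
  Products and categories are numbered from 1. The values of the fields outside
  \<open>{1..num_products}\<close> and \<open>{1..num_categories}\<close>, respectively, play no role.
\<close>

record assortment_instance =
  num_products :: nat
  revenue :: "nat \<Rightarrow> real"
  weight :: "nat \<Rightarrow> real"
  num_categories :: nat
  category :: "nat \<Rightarrow> nat set"
  threshold :: "nat \<Rightarrow> nat"

definition products :: "assortment_instance \<Rightarrow> nat set" where
  "products I = {1..num_products I}"

definition categories :: "assortment_instance \<Rightarrow> nat set" where
  "categories I = {1..num_categories I}"

definition valid_instance :: "assortment_instance \<Rightarrow> bool" where
  "valid_instance I \<longleftrightarrow>
     (\<forall>i\<in>products I. revenue I i \<ge> 0 \<and> weight I i > 0) \<and>
     (\<forall>k\<in>categories I. category I k \<subseteq> products I \<and> threshold I k \<le> card (category I k))"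

definition expected_revenue :: "assortment_instance \<Rightarrow> nat set \<Rightarrow> real" where
  "expected_revenue I S =
     (\<Sum>i\<in>S. revenue I i * weight I i) / (1 + (\<Sum>i\<in>S. weight I i))"

definition daoc_feasible :: "assortment_instance \<Rightarrow> nat set \<Rightarrow> bool" where
  "daoc_feasible I S \<longleftrightarrow>
     S \<subseteq> products I \<and> (\<forall>k\<in>categories I. card (S \<inter> category I k) \<ge> threshold I k)"

text \<open>
  A randomized assortment is a function on all sets of naturals of which only the
  restriction to \<open>Pow (products I)\<close> is constrained and enters the objective.
\<close>

definition raoc_feasible :: "assortment_instance \<Rightarrow> (nat set \<Rightarrow> real) \<Rightarrow> bool" where
  "raoc_feasible I q \<longleftrightarrow>
     (\<forall>k\<in>categories I.
        (\<Sum>S\<in>Pow (products I). real (card (S \<inter> category I k)) * q S) \<ge> real (threshold I k)) \<and>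
     (\<Sum>S\<in>Pow (products I). q S) = 1 \<and>
     (\<forall>S\<in>Pow (products I). q S \<ge> 0)"

definition raoc_objective :: "assortment_instance \<Rightarrow> (nat set \<Rightarrow> real) \<Rightarrow> real" where
  "raoc_objective I q = (\<Sum>S\<in>Pow (products I). expected_revenue I S * q S)"

text \<open>The optimal value is required to be attained by a feasible solution.\<close>

definition is_optimal_value :: "('a \<Rightarrow> real) \<Rightarrow> ('a \<Rightarrow> bool) \<Rightarrow> real \<Rightarrow> bool" where
  "is_optimal_value f feasible z \<longleftrightarrow> (\<exists>x. is_arg_max f feasible x \<and> z = f x)"

definition daoc_optimal_value :: "assortment_instance \<Rightarrow> real \<Rightarrow> bool" where
  "daoc_optimal_value I = is_optimal_value (expected_revenue I) (daoc_feasible I)"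

definition raoc_optimal_value :: "assortment_instance \<Rightarrow> real \<Rightarrow> bool" where
  "raoc_optimal_value I = is_optimal_value (raoc_objective I) (raoc_feasible I)"

end

theory Submission
  imports Defs
begin

text \<open>
  A threshold can force a deterministic assortment to offer a heavy product that earns nothing,
  whereas a randomized assortment may concentrate all such products on part of the time.
  Take one profitable product of revenue and weight 1, and two worthless products of weight \<open>w\<close>;
  the latter form the only category, with threshold 1. Every deterministic solution offers a
  worthless product, so its revenue is at most \<open>1 / (2 + w)\<close>. Offering the profitable product alone
  half of the time and everything the other half also meets the threshold, on average, and its
  revenue stays above \<open>1 / 4\<close>. Hence the ratio grows linearly in \<open>w\<close>.

  That this mixture is optimal follows from linear programming duality. With the profitable
  product on offer, the revenue \<open>1 / (2 + w x)\<close> is a convex function of the number \<open>x\<close> of worthless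
  products, so on \<open>0 \<le> x \<le> 2\<close> it lies below the chord between \<open>x = 0\<close> and \<open>x = 2\<close>; without that
  product the revenue is 0, which is below the chord as well. Slope and intercept of the chord
  thus form a dual solution, and its value equals that of the mixture.
\<close>

text \<open>
  Weak duality for the randomized problem: \<open>mu k\<close> is the multiplier of the threshold constraint
  of category \<open>k\<close>, and \<open>b\<close> that of the normalization of \<open>q\<close>.
\<close>

lemma raoc_weak_duality:
  assumes feasible: "raoc_feasible I q"
    and mu_nonneg: "\<And>k. k \<in> categories I \<Longrightarrow> mu k \<ge> 0"
    and dual_feasible: "\<And>S. S \<subseteq> products I \<Longrightarrow>
      expected_revenue I S + (\<Sum>k\<in>categories I. mu k * real (card (S \<inter> category I k))) \<le> b"
  shows "raoc_objective I q \<le> b - (\<Sum>k\<in>categories I. mu k * real (threshold I k))"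
proof -
  let ?P = "Pow (products I)"
  let ?c = "\<lambda>S k. real (card (S \<inter> category I k))"
  have "(\<Sum>k\<in>categories I. mu k * real (threshold I k))
      \<le> (\<Sum>k\<in>categories I. mu k * (\<Sum>S\<in>?P. ?c S k * q S))"
    using feasible mu_nonneg by (intro sum_mono mult_left_mono) (auto simp: raoc_feasible_def)
  also have "\<dots> = (\<Sum>S\<in>?P. (\<Sum>k\<in>categories I. mu k * ?c S k) * q S)"
    unfolding sum_distrib_left sum_distrib_right
    by (subst sum.swap) (simp add: mult.assoc)
  finally have "raoc_objective I q + (\<Sum>k\<in>categories I. mu k * real (threshold I k))
      \<le> (\<Sum>S\<in>?P. (expected_revenue I S + (\<Sum>k\<in>categories I. mu k * ?c S k)) * q S)"
    by (simp add: raoc_objective_def distrib_right sum.distrib)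
  also have "\<dots> \<le> (\<Sum>S\<in>?P. b * q S)"
    using feasible dual_feasible
    by (intro sum_mono mult_right_mono) (auto simp: raoc_feasible_def)
  also have "\<dots> = b"
    using feasible by (simp add: raoc_feasible_def flip: sum_distrib_left)
  finally show ?thesis by simp
qed

definition dilution_instance :: "real \<Rightarrow> assortment_instance" where
  "dilution_instance w = \<lparr>num_products = 3,
     revenue = (\<lambda>i. of_bool (i = 1)),
     weight = (\<lambda>i. if i = 1 then 1 else w),
     num_categories = 1,
     category = (\<lambda>_. {2, 3}),
     threshold = (\<lambda>_. 1)\<rparr>"

lemma dilution_instance_simps [simp]:
  "products (dilution_instance w) = {1, 2, 3}"
  "categories (dilution_instance w) = {1}"
  "num_categories (dilution_instance w) = 1"
  "category (dilution_instance w) k = {2, 3}"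
  "threshold (dilution_instance w) k = 1"
  by (auto simp: dilution_instance_def products_def categories_def)

lemma valid_dilution_instance: "w > 0 \<Longrightarrow> valid_instance (dilution_instance w)"
  unfolding valid_instance_def by (simp, simp add: dilution_instance_def)

lemma expected_revenue_dilution_instance:
  assumes "S \<subseteq> {1, 2, 3}"
  shows "expected_revenue (dilution_instance w) S =
    (if 1 \<in> S then 1 / (2 + w * real (card (S \<inter> {2, 3}))) else 0)"
proof -
  have S: "S = (S \<inter> {1}) \<union> (S \<inter> {2, 3})" using assms by auto
  have split: "sum f S = sum f (S \<inter> {1}) + sum f (S \<inter> {2, 3})" for f :: "nat \<Rightarrow> real"
    by (subst S, rule sum.union_disjoint) auto
  have weights: "sum (weight (dilution_instance w)) (S \<inter> {2, 3}) = w * real (card (S \<inter> {2, 3}))"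
    by (subst sum.cong[OF refl, where h = "\<lambda>_. w"]) (auto simp: dilution_instance_def)
  have revenues: "(\<Sum>i\<in>S \<inter> {2, 3}. revenue (dilution_instance w) i * weight (dilution_instance w) i) = 0"
    by (rule sum.neutral) (auto simp: dilution_instance_def)
  show ?thesis
    unfolding expected_revenue_def split weights revenues
    by (cases "1 \<in> S") (auto simp: dilution_instance_def Int_insert_right)
qed

lemma daoc_optimal_value_dilution_instance:
  assumes "w > 0"
  shows "daoc_optimal_value (dilution_instance w) (1 / (2 + w))"
proof -
  let ?I = "dilution_instance w"
  have attained: "expected_revenue ?I {1, 2} = 1 / (2 + w)"
    by (subst expected_revenue_dilution_instance) auto
  have bound: "expected_revenue ?I S \<le> 1 / (2 + w)" if "daoc_feasible ?I S" for S
  proof -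
    have S: "S \<subseteq> {1, 2, 3}" and "card (S \<inter> {2, 3}) \<ge> 1"
      using that by (auto simp: daoc_feasible_def)
    then have "w * 1 \<le> w * real (card (S \<inter> {2, 3}))"
      using assms by (intro mult_left_mono) auto
    then have "1 / (2 + w * real (card (S \<inter> {2, 3}))) \<le> 1 / (2 + w)"
      using assms by (simp add: frac_le)
    then show ?thesis
      using assms by (simp add: expected_revenue_dilution_instance[OF S])
  qed
  have "daoc_feasible ?I {1, 2}" by (auto simp: daoc_feasible_def)
  then have "is_arg_max (expected_revenue ?I) (daoc_feasible ?I) {1, 2}"
    using bound unfolding is_arg_max_linorder attained by blast
  then show ?thesis
    using attained by (metis daoc_optimal_value_def is_optimal_value_def)
qed

lemma raoc_optimal_value_dilution_instance:
  assumes "w > 0"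
  shows "raoc_optimal_value (dilution_instance w) ((2 + w) / (4 * (1 + w)))"
proof -
  let ?I = "dilution_instance w"
  \<comment> \<open>The negated slope of the chord of \<open>x \<mapsto> 1 / (2 + w x)\<close> over \<open>0 \<le> x \<le> 2\<close>.\<close>
  define mu where "mu = w / (4 * (1 + w))"
  define q :: "nat set \<Rightarrow> real" where
    "q = (\<lambda>S. of_bool (S = {1}) / 2 + of_bool (S = {1, 2, 3}) / 2)"
  have mixture: "(\<Sum>S\<in>Pow {1, 2, 3}. f S * q S) = (f {1} + f {1, 2, 3}) / 2"
    for f :: "nat set \<Rightarrow> real"
  proof -
    have "(\<Sum>S\<in>Pow {1, 2, 3}. f S * q S)
        = (\<Sum>S\<in>Pow {1, 2, 3}. (if S = {1} then f S / 2 else 0) + (if S = {1, 2, 3} then f S / 2 else 0))"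
      by (rule sum.cong) (auto simp: q_def)
    also have "\<dots> = (f {1} + f {1, 2, 3}) / 2"
      unfolding sum.distrib by (subst (1 2) sum.delta) (auto simp: add_divide_distrib)
    finally show ?thesis .
  qed
  have feasible: "raoc_feasible ?I q"
    using mixture[of "\<lambda>S. real (card (S \<inter> {2, 3}))"] mixture[of "\<lambda>_. 1"]
    by (simp add: raoc_feasible_def q_def)
  have attained: "raoc_objective ?I q = (2 + w) / (4 * (1 + w))"
  proof -
    have "raoc_objective ?I q = (1 / 2 + 1 / (2 + w * 2)) / 2"
      using mixture[of "expected_revenue ?I"]
      by (simp add: raoc_objective_def expected_revenue_dilution_instance)
    also have "\<dots> = (2 + w) / (4 * (1 + w))"
      using assms by (simp add: field_simps)
    finally show ?thesis .
  qed
  have chord: "expected_revenue ?I S + mu * real (card (S \<inter> {2, 3})) \<le> 1 / 2"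
    if S: "S \<subseteq> {1, 2, 3}" for S
  proof -
    have "card (S \<inter> {2, 3}) \<le> card {2, 3 :: nat}" by (intro card_mono) auto
    then have "card (S \<inter> {2, 3}) \<le> 2" by simp
    then consider "card (S \<inter> {2, 3}) = 0" | "card (S \<inter> {2, 3}) = 1" | "card (S \<inter> {2, 3}) = 2"
      by linarith
    moreover have "1 / (2 + w) + mu \<le> 1 / 2"
    proof -
      have "1 / 2 - (1 / (2 + w) + mu) = w\<^sup>2 / (4 * (1 + w) * (2 + w))"
        using assms by (simp add: mu_def divide_simps) (simp add: algebra_simps power2_eq_square)
      moreover have "w\<^sup>2 / (4 * (1 + w) * (2 + w)) \<ge> 0" using assms by simp
      ultimately show ?thesis by linarith
    qed
    moreover have "mu * 2 \<le> 1 / 2" "1 / (2 + w * 2) + mu * 2 \<le> 1 / 2"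
      "0 \<le> mu"
      using assms by (simp_all add: mu_def field_simps)
    ultimately show ?thesis
      unfolding expected_revenue_dilution_instance[OF S] by cases (simp_all only:, auto)
  qed
  have bound: "raoc_objective ?I p \<le> (2 + w) / (4 * (1 + w))" if "raoc_feasible ?I p" for p
  proof -
    have "raoc_objective ?I p \<le> 1 / 2 - mu"
      using raoc_weak_duality[OF that, of "\<lambda>_. mu" "1 / 2"] chord assms
      by (simp add: mu_def)
    also have "\<dots> = (2 + w) / (4 * (1 + w))"
      using assms by (simp add: mu_def field_simps)
    finally show ?thesis .
  qed
  have "is_arg_max (raoc_objective ?I) (raoc_feasible ?I) q"
    using feasible bound unfolding is_arg_max_linorder attained by blast
  then show ?thesis
    using attained by (metis raoc_optimal_value_def is_optimal_value_def)
qed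

theorem proposition9:
  fixes M :: real
  assumes "M > 0"
  shows "\<exists>(I :: assortment_instance) z_d z_r.
           valid_instance I \<and> num_categories I = 1 \<and>
           daoc_optimal_value I z_d \<and> raoc_optimal_value I z_r \<and>
           z_d > 0 \<and> z_r / z_d \<ge> M"
proof -
  \<comment> \<open>The ratio is \<open>(2 + w)\<^sup>2 / (4 * (1 + w))\<close>, which is at least \<open>w / 4\<close>.\<close>
  define w where "w = 4 * M"
  have w: "w > 0" using assms by (simp add: w_def)
  have "M * (4 * (1 + w)) \<le> (2 + w) * (2 + w)"
    using w by (simp add: w_def algebra_simps)
  then have "M \<le> (2 + w) / (4 * (1 + w)) / (1 / (2 + w))"
    using w by (simp add: pos_le_divide_eq)
  then show ?thesis
    using w valid_dilution_instance[OF w] daoc_optimal_value_dilution_instance[OF w]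
      raoc_optimal_value_dilution_instance[OF w]
    by (intro exI[of _ "dilution_instance w"] exI[of _ "1 / (2 + w)"]
        exI[of _ "(2 + w) / (4 * (1 + w))"]) simp
qed

end
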